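(* Let $\mu_1,\mu_2$ be two LJSDs with $\mu_1\le\mu_2$ (i.e. $\mu_1$ is easier than $\mu_2$). Then the limiting bias and test error of random feature regression satisfy $$B_{\mu_1}\le B_{\mu_2}\quad\text{if}\quad \xi_2\le\xi_1\le1,$$ $$E_{\mu_1}\le E_{\mu_2}\quad\text{if}\quad \xi_2\le\xi_1\le1\le\zeta_2/\zeta_1\le\eta_2/\eta_1\quad\text{and}\quad\sigma_\varepsilon^2\le\omega .$$
   Context: Parameters: $\phi,\psi>0$, ridge constant $\gamma>0$, label noise $\sigma_\varepsilon^2\ge0$. Activation $\sigma:\mathbb{R}\to\mathbb{R}$, differentiable almost everywhere with $|\sigma(u)|,|\sigma'(u)|\le c_0e^{c_1|u|}$. LJSD: a limiting joint spectral distribution is a probability measure $\mu$ on $\mathbb{R}_+^2$, the law of a pair $(\lambda,r)$ (training eigenvalue, overlap coefficient of the test covariance), supported in $[0,C]^2$ for some $C$, either absolutely continuous or a finite sum of delta masses; $\mathbb{E}_\mu[\lambda],\mathbb{E}_\mu[r]$ are finite and positive. The marginal of $\lambda$ is $\mu_{\text{train}}$. Order: for LJSDs $\mu_1,\mu_2$ with the same marginal of $\lambda$, $\mu_1\le\mu_2$ ("$\mu_1$ is easier than $\mu_2$") means that $\mathbb{E}_{\mu_1}[r|\lambda]/\mathbb{E}_{\mu_2}[r|\lambda]$ is nondecreasing in $\lambda$ on the support of $\mu_{\text{train}}$ and $\mathbb{E}_{\mu_1}[r]\le\mathbb{E}_{\mu_2}[r]$. Constants: for a scale $t>0$ and $z\sim\mathcal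 N(0,t)$ put $\Omega_\sigma(t)=(\eta,\rho,\zeta,\omega)$ with $\eta=\mathbb{V}[\sigma(z)]$, $\rho=(\frac1t\mathbb{E}[z\sigma(z)])^2$, $\zeta=t\rho$, $\omega=t(\eta/\zeta-1)$ (assumed well defined). With $s=\mathbb{E}[\lambda]$: $(\eta,\rho,\zeta,\omega)=\Omega_\sigma(s)$. For an LJSD $\mu$ with $s_*=\mathbb{E}_\mu[r]$: $(\eta_*,\rho_*,\zeta_*,\omega_* )=\Omega_\sigma(s_* )$, $\xi=\sqrt{\rho_*/\rho}$. For $\mu_i$ these are written with subscript $i$: $s_i=\mathbb{E}_{\mu_i}[r]$, $(\eta_i,\rho_i,\zeta_i,\omega_i)=\Omega_\sigma(s_i)$, $\xi_i=\sqrt{\rho_i/\rho}$. Functionals: $\mathcal{I}_{a,b}(x)=\phi\,\mathbb{E}_\mu[\lambda^a(\phi+x\lambda)^{-b}]$, $\mathcal{I}^*_{a,b}(x)=\phi\,\mathbb{E}_\mu[r\lambda^{a-1}(\phi+x\lambda)^{-b}]$. Limiting bias, variance, error: $x$ is the unique nonnegative real root of $x=(1-\gamma\tau)/(\omega+\mathcal{I}_{1,1}(x))$, with $\tau=\frac{\sqrt{(\psi-\phi)^2+4x\psi\phi\gamma/\rho}+\psi-\phi}{2\psi\gamma}$, $\bar\tau=\frac{\phi-\psi}{\phi}\frac1\gamma+\frac\psi\phi\tau$, $\frac{\partial x}{\partial\gamma}=-\frac{x}{\gamma+\rho\gamma(\tau\psi/\phi+\bar\tau)(\omega+\phi\mathcal{I}_{1,2})}$.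 With functionals evaluated at $x$, $B_\mu=(1-\xi)^2s_*+2(1-\xi)\xi\mathcal{I}^*_{1,1}+\xi^2\phi\mathcal{I}^*_{1,2}$, $V_\mu=-\rho\xi^2\frac\psi\phi\frac{\partial x}{\partial\gamma}\big(\mathcal{I}_{1,1}(\omega+\phi\mathcal{I}_{1,2})(\omega_*+\mathcal{I}^*_{1,1})+\frac{\phi^2}\psi\gamma\bar\tau\mathcal{I}_{1,2}\mathcal{I}^*_{2,2}+\gamma\tau\mathcal{I}_{2,2}(\omega_*+\phi\mathcal{I}^*_{1,2})+\sigma_\varepsilon^2((\omega+\phi\mathcal{I}_{1,2})(\omega_*+\mathcal{I}^*_{1,1})+\frac\phi\psi\gamma\bar\tau\mathcal{I}^*_{2,2})\big)$, and $E_\mu=B_\mu+V_\mu$. *)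

theory Defs
  imports "HOL-Probability.Probability"
begin

section \<open>Limiting joint spectral distributions and their order\<close>

text \<open>A pair \<open>(\<lambda>, r)\<close> is an element of \<^typ>\<open>real \<times> real\<close>: \<open>fst\<close> is the training eigenvalue
  and \<open>snd\<close> the overlap coefficient. Since the support is bounded, \<open>fst\<close> and \<open>snd\<close> are integrable.\<close>

definition LJSD :: "(real \<times> real) measure \<Rightarrow> bool" where
  "LJSD \<mu> \<longleftrightarrow>
     prob_space \<mu> \<and> sets \<mu> = sets borel \<and>
     (\<exists>C. AE p in \<mu>. p \<in> {0..C} \<times> {0..C}) \<and>
     (absolutely_continuous lborel \<mu> \<or> (\<exists>S. finite S \<and> (AE p in \<mu>. p \<in> S))) \<and>
     0 < (LINT p|\<mu>. fst p) \<and> 0 < (LINT p|\<mu>. snd p)"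

definition train_marginal :: "(real \<times> real) measure \<Rightarrow> real measure" where
  "train_marginal \<mu> = distr \<mu> borel fst"

definition topological_support :: "'a::topological_space measure \<Rightarrow> 'a set" where
  "topological_support M = {x. \<forall>U. open U \<and> x \<in> U \<longrightarrow> emeasure M U > 0}"

text \<open>\<open>g\<close> is a version of \<open>l \<mapsto> E[r | \<lambda> = l]\<close>; such a \<open>g\<close> is determined only up to null sets of
  the marginal of \<open>\<lambda>\<close>.\<close>

definition overlap_given_eigenvalue :: "(real \<times> real) measure \<Rightarrow> (real \<Rightarrow> real) \<Rightarrow> bool" where
  "overlap_given_eigenvalue \<mu> g \<longleftrightarrow>
     g \<in> borel_measurable borel \<and>
     (AE p in \<mu>. real_cond_exp \<mu> (vimage_algebra UNIV fst borel) snd p = g (fst p))"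

text \<open>The ratio of the conditional expectations is taken in \<open>[0, \<infinity>]\<close>, so that it equals \<open>\<infinity>\<close> where only
  the denominator vanishes; points where it is \<open>0 / 0\<close> are left out. Monotonicity is required for
  suitable versions.\<close>

definition easier :: "(real \<times> real) measure \<Rightarrow> (real \<times> real) measure \<Rightarrow> bool" where
  "easier \<mu>1 \<mu>2 \<longleftrightarrow>
     train_marginal \<mu>1 = train_marginal \<mu>2 \<and>
     (\<exists>g1 g2. overlap_given_eigenvalue \<mu>1 g1 \<and> overlap_given_eigenvalue \<mu>2 g2 \<and>
        mono_on {l \<in> topological_support (train_marginal \<mu>1). g1 l > 0 \<or> g2 l > 0}
          (\<lambda>l. ennreal (g1 l) / ennreal (g2 l))) \<and>
     (LINT p|\<mu>1. snd p) \<le> (LINT p|\<mu>2. snd p)"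


section \<open>Activation constants\<close>

definition admissible_activation :: "(real \<Rightarrow> real) \<Rightarrow> bool" where
  "admissible_activation \<sigma> \<longleftrightarrow>
     (\<exists>c0 c1. (\<forall>u. \<bar>\<sigma> u\<bar> \<le> c0 * exp (c1 * \<bar>u\<bar>)) \<and>
        (AE u in lebesgue. \<sigma> differentiable (at u) \<and> \<bar>deriv \<sigma> u\<bar> \<le> c0 * exp (c1 * \<bar>u\<bar>)))"

text \<open>The centred Gaussian with variance \<open>t\<close>. It lives on the Lebesgue sets because a function that
  is differentiable almost everywhere is Lebesgue measurable but need not be Borel measurable.\<close>

definition gaussian :: "real \<Rightarrow> real measure" where
  "gaussian t = density lebesgue (\<lambda>z. ennreal (normal_density 0 (sqrt t) z))"

definition eta :: "(real \<Rightarrow> real) \<Rightarrow> real \<Rightarrow> real" where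
  "eta \<sigma> t = prob_space.variance (gaussian t) \<sigma>"

definition rho :: "(real \<Rightarrow> real) \<Rightarrow> real \<Rightarrow> real" where
  "rho \<sigma> t = (1 / t * (LINT z|gaussian t. z * \<sigma> z))\<^sup>2"

definition zeta :: "(real \<Rightarrow> real) \<Rightarrow> real \<Rightarrow> real" where
  "zeta \<sigma> t = t * rho \<sigma> t"

definition omega :: "(real \<Rightarrow> real) \<Rightarrow> real \<Rightarrow> real" where
  "omega \<sigma> t = t * (eta \<sigma> t / zeta \<sigma> t - 1)"

definition Omega_well_defined :: "(real \<Rightarrow> real) \<Rightarrow> real \<Rightarrow> bool" where
  "Omega_well_defined \<sigma> t \<longleftrightarrow> t > 0 \<and> zeta \<sigma> t \<noteq> 0"

definition train_scale :: "(real \<times> real) measure \<Rightarrow> real" where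
  "train_scale \<mu> = (LINT p|\<mu>. fst p)"

definition test_scale :: "(real \<times> real) measure \<Rightarrow> real" where
  "test_scale \<mu> = (LINT p|\<mu>. snd p)"

definition xi :: "(real \<Rightarrow> real) \<Rightarrow> (real \<times> real) measure \<Rightarrow> real" where
  "xi \<sigma> \<mu> = sqrt (rho \<sigma> (test_scale \<mu>) / rho \<sigma> (train_scale \<mu>))"


section \<open>Limiting bias, variance and test error\<close>

definition I_fun :: "real \<Rightarrow> (real \<times> real) measure \<Rightarrow> nat \<Rightarrow> nat \<Rightarrow> real \<Rightarrow> real" where
  "I_fun \<phi> \<mu> a b x = \<phi> * (LINT p|\<mu>. fst p ^ a / (\<phi> + x * fst p) ^ b)"

text \<open>Only used with \<open>a \<ge> 1\<close>; for \<open>a = 1\<close> the factor \<open>\<lambda> ^ (a - 1)\<close> is \<open>1\<close>, also at \<open>\<lambda> = 0\<close>.\<close>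

definition I_star :: "real \<Rightarrow> (real \<times> real) measure \<Rightarrow> nat \<Rightarrow> nat \<Rightarrow> real \<Rightarrow> real" where
  "I_star \<phi> \<mu> a b x = \<phi> * (LINT p|\<mu>. snd p * fst p ^ (a - 1) / (\<phi> + x * fst p) ^ b)"

definition tau_at :: "real \<Rightarrow> real \<Rightarrow> real \<Rightarrow> real \<Rightarrow> real \<Rightarrow> real" where
  "tau_at \<phi> \<psi> \<gamma> \<rho> x =
     (sqrt ((\<psi> - \<phi>)\<^sup>2 + 4 * x * \<psi> * \<phi> * \<gamma> / \<rho>) + \<psi> - \<phi>) / (2 * \<psi> * \<gamma>)"

definition x_root ::
  "real \<Rightarrow> real \<Rightarrow> real \<Rightarrow> (real \<Rightarrow> real) \<Rightarrow> (real \<times> real) measure \<Rightarrow> real" where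
  "x_root \<phi> \<psi> \<gamma> \<sigma> \<mu> =
     (THE x. x \<ge> 0 \<and>
        x = (1 - \<gamma> * tau_at \<phi> \<psi> \<gamma> (rho \<sigma> (train_scale \<mu>)) x) /
            (omega \<sigma> (train_scale \<mu>) + I_fun \<phi> \<mu> 1 1 x))"

definition tau ::
  "real \<Rightarrow> real \<Rightarrow> real \<Rightarrow> (real \<Rightarrow> real) \<Rightarrow> (real \<times> real) measure \<Rightarrow> real" where
  "tau \<phi> \<psi> \<gamma> \<sigma> \<mu> = tau_at \<phi> \<psi> \<gamma> (rho \<sigma> (train_scale \<mu>)) (x_root \<phi> \<psi> \<gamma> \<sigma> \<mu>)"

definition tau_bar ::
  "real \<Rightarrow> real \<Rightarrow> real \<Rightarrow> (real \<Rightarrow> real) \<Rightarrow> (real \<times> real) measure \<Rightarrow> real" where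
  "tau_bar \<phi> \<psi> \<gamma> \<sigma> \<mu> = (\<phi> - \<psi>) / \<phi> * (1 / \<gamma>) + \<psi> / \<phi> * tau \<phi> \<psi> \<gamma> \<sigma> \<mu>"

text \<open>The closed form of the derivative of the root with respect to \<open>\<gamma>\<close>, obtained by implicit
  differentiation of the equation in \<^const>\<open>x_root\<close>.\<close>

definition dx_dgamma ::
  "real \<Rightarrow> real \<Rightarrow> real \<Rightarrow> (real \<Rightarrow> real) \<Rightarrow> (real \<times> real) measure \<Rightarrow> real" where
  "dx_dgamma \<phi> \<psi> \<gamma> \<sigma> \<mu> =
     (let x = x_root \<phi> \<psi> \<gamma> \<sigma> \<mu>;
          \<rho> = rho \<sigma> (train_scale \<mu>);
          \<omega> = omega \<sigma> (train_scale \<mu>)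
      in - (x / (\<gamma> + \<rho> * \<gamma> * (tau \<phi> \<psi> \<gamma> \<sigma> \<mu> * \<psi> / \<phi> + tau_bar \<phi> \<psi> \<gamma> \<sigma> \<mu>) *
                    (\<omega> + \<phi> * I_fun \<phi> \<mu> 1 2 x))))"

definition limiting_bias ::
  "real \<Rightarrow> real \<Rightarrow> real \<Rightarrow> (real \<Rightarrow> real) \<Rightarrow> (real \<times> real) measure \<Rightarrow> real" where
  "limiting_bias \<phi> \<psi> \<gamma> \<sigma> \<mu> =
     (let x = x_root \<phi> \<psi> \<gamma> \<sigma> \<mu>; \<xi> = xi \<sigma> \<mu>
      in (1 - \<xi>)\<^sup>2 * test_scale \<mu> + 2 * (1 - \<xi>) * \<xi> * I_star \<phi> \<mu> 1 1 x
         + \<xi>\<^sup>2 * \<phi> * I_star \<phi> \<mu> 1 2 x)"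

text \<open>The argument \<open>v\<close> is the label noise variance.\<close>

definition limiting_variance ::
  "real \<Rightarrow> real \<Rightarrow> real \<Rightarrow> real \<Rightarrow> (real \<Rightarrow> real) \<Rightarrow> (real \<times> real) measure \<Rightarrow> real" where
  "limiting_variance \<phi> \<psi> \<gamma> v \<sigma> \<mu> =
     (let x = x_root \<phi> \<psi> \<gamma> \<sigma> \<mu>;
          \<xi> = xi \<sigma> \<mu>;
          \<rho> = rho \<sigma> (train_scale \<mu>);
          \<omega> = omega \<sigma> (train_scale \<mu>);
          \<omega>s = omega \<sigma> (test_scale \<mu>);
          \<tau> = tau \<phi> \<psi> \<gamma> \<sigma> \<mu>;
          \<tau>b = tau_bar \<phi> \<psi> \<gamma> \<sigma> \<mu>;
          I = (\<lambda>a b. I_fun \<phi> \<mu> a b x);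
          J = (\<lambda>a b. I_star \<phi> \<mu> a b x)
      in - \<rho> * \<xi>\<^sup>2 * (\<psi> / \<phi>) * dx_dgamma \<phi> \<psi> \<gamma> \<sigma> \<mu> *
         (I 1 1 * (\<omega> + \<phi> * I 1 2) * (\<omega>s + J 1 1)
          + \<phi>\<^sup>2 / \<psi> * \<gamma> * \<tau>b * I 1 2 * J 2 2
          + \<gamma> * \<tau> * I 2 2 * (\<omega>s + \<phi> * J 1 2)
          + v * ((\<omega> + \<phi> * I 1 2) * (\<omega>s + J 1 1) + \<phi> / \<psi> * \<gamma> * \<tau>b * J 2 2)))"

definition limiting_error ::
  "real \<Rightarrow> real \<Rightarrow> real \<Rightarrow> real \<Rightarrow> (real \<Rightarrow> real) \<Rightarrow> (real \<times> real) measure \<Rightarrow> real" where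
  "limiting_error \<phi> \<psi> \<gamma> v \<sigma> \<mu> =
     limiting_bias \<phi> \<psi> \<gamma> \<sigma> \<mu> + limiting_variance \<phi> \<psi> \<gamma> v \<sigma> \<mu>"

end

theory Submission
  imports Defs
begin

text \<open>Put \<open>u = \<phi> / (\<phi> + x \<lambda>)\<close>, a nonincreasing function of \<open>\<lambda>\<close> with values in \<open>[0, 1]\<close>. The root \<open>x\<close>
  and all functionals without a star depend on the marginal of \<open>\<lambda>\<close> only, so they agree for both
  distributions. Since an easier distribution puts relatively more overlap on large \<open>\<lambda>\<close>, Chebyshev's
  association inequality gives \<open>E\<^sub>1[r h] / E\<^sub>1[r] \<le> E\<^sub>2[r h] / E\<^sub>2[r]\<close> for nonincreasing \<open>h \<ge> 0\<close>.

  The bias is \<open>E[r (1 - \<xi> + \<xi> u)\<^sup>2]\<close>, which settles the first claim. The variance contains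
  \<open>x I\<^sup>*\<^sub>2\<^sub>2 = E[r u (1 - u)]\<close>, whose integrand is not monotone in \<open>\<lambda>\<close>. Its total weight is \<open>\<xi>\<^sup>2 \<kappa>\<close>, where
  \<open>\<kappa> \<le> 1\<close> because the label noise is at most \<open>\<omega>\<close>, and for such \<open>\<kappa>\<close> the sum
  \<open>(1 - \<xi> + \<xi> u)\<^sup>2 + \<xi>\<^sup>2 \<kappa> u (1 - u)\<close> is still increasing in \<open>u\<close> and decreasing in \<open>\<xi>\<close>. The remaining terms
  of the variance are nonnegative multiples of \<open>\<rho>\<^sub>* \<omega>\<^sub>* = \<eta>\<^sub>* - \<zeta>\<^sub>*\<close>, \<open>\<rho>\<^sub>* E[r u]\<close> and \<open>\<rho>\<^sub>* E[r u\<^sup>2]\<close>, and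
  these grow because \<open>\<rho>\<^sub>* E[r] = \<zeta>\<^sub>*\<close> and \<open>\<eta>\<^sub>* / \<zeta>\<^sub>*\<close> do.\<close>

section \<open>Gaussian moments of the activation\<close>

text \<open>The function is continuous on the complement of a null set, hence measurable there, and
  values on a null set do not affect measurability for the complete measure. This serves the
  activation, which is differentiable almost everywhere.\<close>

lemma borel_measurable_lebesgue_AE_isCont:
  fixes f :: "real \<Rightarrow> real"
  assumes "AE u in lebesgue. isCont f u"
  shows "f \<in> borel_measurable lebesgue"
proof -
  obtain N where N: "N \<in> null_sets lebesgue" "{u. \<not> isCont f u} \<subseteq> N"
    using assms unfolding eventually_ae_filter by auto
  have S: "- N \<in> sets lebesgue"
    using N(1) Compl_in_sets_lebesgue by blast
  have "continuous_on (- N) f"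
    using N(2) by (intro continuous_at_imp_continuous_on) auto
  then have "f \<in> borel_measurable (lebesgue_on (- N))"
    using S by (rule continuous_imp_measurable_on_sets_lebesgue)
  then have "(\<lambda>u. if u \<in> - N then f u else 0) \<in> borel_measurable lebesgue"
    using S by (rule borel_measurable_if_I)
  moreover have "AE u in lebesgue. (if u \<in> - N then f u else 0) = f u"
    using AE_not_in[OF N(1)] by (rule AE_mp) simp
  ultimately show ?thesis
    by (rule borel_measurable_AE)
qed

lemma prob_space_gaussian:
  assumes "t > 0"
  shows "prob_space (gaussian t)"
proof -
  interpret N: prob_space "density lborel (normal_density 0 (sqrt t))"
    using assms by (intro prob_space_normal_density) simp
  have "emeasure (gaussian t) UNIV = emeasure (density lborel (normal_density 0 (sqrt t))) UNIV"
    unfolding gaussian_def by (simp add: emeasure_density nn_integral_completion measurable_completion)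
  also have "\<dots> = 1"
    using N.emeasure_space_1 by simp
  finally show ?thesis
    by (intro prob_spaceI) (simp add: gaussian_def)
qed

lemma integrable_gaussian_borel_iff:
  fixes f :: "real \<Rightarrow> real"
  assumes "f \<in> borel_measurable borel"
  shows "integrable (gaussian t) f \<longleftrightarrow> integrable lborel (\<lambda>z. normal_density 0 (sqrt t) z * f z)"
proof -
  have "(\<lambda>z. normal_density 0 (sqrt t) z * f z) \<in> borel_measurable lborel"
    using assms by simp
  then show ?thesis
    unfolding gaussian_def using assms
    by (subst integrable_density) (auto simp: measurable_completion integrable_completion)
qed

lemma integral_gaussian_borel:
  fixes f :: "real \<Rightarrow> real"
  assumes "f \<in> borel_measurable borel"
  shows "(LINT z|gaussian t. f z) = (LINT z|lborel. normal_density 0 (sqrt t) z * f z)"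
proof -
  have "(\<lambda>z. normal_density 0 (sqrt t) z * f z) \<in> borel_measurable lborel"
    using assms by simp
  then show ?thesis
    unfolding gaussian_def using assms
    by (subst integral_density) (auto simp: measurable_completion integral_completion)
qed

lemma integrable_gaussian_exp:
  assumes "t > 0"
  shows "integrable (gaussian t) (\<lambda>z. exp (c * z))"
proof -
  \<comment> \<open>Completing the square: the exponentially tilted density is a constant times the
    normal density with mean \<open>c * t\<close>.\<close>
  have "- z\<^sup>2 / (2 * t) + c * z = c\<^sup>2 * t / 2 - (z - c * t)\<^sup>2 / (2 * t)" for z
    using assms by (simp add: field_simps power2_eq_square)
  then have "normal_density 0 (sqrt t) z * exp (c * z)
      = exp (c\<^sup>2 * t / 2) * normal_density (c * t) (sqrt t) z" for z
    using assms unfolding normal_density_def by (simp flip: exp_add)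
  then show ?thesis
    using assms by (subst integrable_gaussian_borel_iff) auto
qed

text \<open>For either sign of \<open>c\<close>, \<open>exp (c * \<bar>z\<bar>)\<close> is one of
  the two summands of \<open>exp (c * z) + exp (- c * z)\<close>, so this sum is an integrable
  majorant.\<close>

lemma integrable_gaussian_of_exp_bound:
  fixes f :: "real \<Rightarrow> real"
  assumes "t > 0" and f: "f \<in> borel_measurable lebesgue"
    and bound: "\<And>z. \<bar>f z\<bar> \<le> K * exp (c * \<bar>z\<bar>)"
  shows "integrable (gaussian t) f"
proof (rule Bochner_Integration.integrable_bound)
  show "integrable (gaussian t) (\<lambda>z. K * (exp (c * z) + exp (- c * z)))"
    by (intro integrable_mult_right Bochner_Integration.integrable_add
        integrable_gaussian_exp[OF \<open>t > 0\<close>])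
  show "f \<in> borel_measurable (gaussian t)"
    using f by (simp add: gaussian_def)
  have "K \<ge> 0"
    using order_trans[OF abs_ge_zero bound[of 0]] by simp
  then have "\<bar>f z\<bar> \<le> K * (exp (c * z) + exp (- c * z))" for z
    using bound[of z] mult_left_mono[of "exp (c * \<bar>z\<bar>)" "exp (c * z) + exp (- c * z)" K]
    by (cases "z \<ge> 0") (auto intro: order_trans)
  then show "AE z in gaussian t. norm (f z) \<le> norm (K * (exp (c * z) + exp (- c * z)))"
    by (intro AE_I2) (auto intro: order_trans[OF _ abs_ge_self])
qed

lemma expectation_gaussian:
  assumes "t > 0"
  shows "(LINT z|gaussian t. z) = 0" and "(LINT z|gaussian t. z\<^sup>2) = t"
  using integral_normal_moment_odd[of "sqrt t" 0 0] integral_normal_moment_even[of "sqrt t" 0 1] assms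
  by (simp_all add: integral_gaussian_borel)

text \<open>Cauchy--Schwarz, from the nonnegative variance of \<open>\<sigma> z - a z\<close> for the regression slope \<open>a\<close>.\<close>

lemma zeta_le_eta:
  assumes \<sigma>: "admissible_activation \<sigma>" and t: "t > 0"
  shows "zeta \<sigma> t \<le> eta \<sigma> t"
proof -
  obtain c0 c1 where bound: "\<And>u. \<bar>\<sigma> u\<bar> \<le> c0 * exp (c1 * \<bar>u\<bar>)"
    and diff: "AE u in lebesgue. \<sigma> differentiable (at u)"
    using \<sigma> unfolding admissible_activation_def by auto
  have [measurable]: "\<sigma> \<in> borel_measurable lebesgue"
    by (rule borel_measurable_lebesgue_AE_isCont[OF AE_mp[OF diff]])
      (auto intro: differentiable_imp_continuous_within)
  have [measurable]: "(\<lambda>z::real. z) \<in> borel_measurable lebesgue"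
    by (simp add: measurable_completion)
  have id_le: "\<bar>z\<bar> \<le> exp \<bar>z\<bar>" for z :: real
    using exp_ge_add_one_self[of "\<bar>z\<bar>"] by linarith
  have "c0 \<ge> 0"
    using order_trans[OF abs_ge_zero bound[of 0]] by simp
  interpret G: prob_space "gaussian t"
    using t by (rule prob_space_gaussian)
  have [simp]: "integrable (gaussian t) \<sigma>"
    using t bound by (intro integrable_gaussian_of_exp_bound) auto
  have [simp]: "integrable (gaussian t) (\<lambda>z. z)"
    using t id_le by (intro integrable_gaussian_of_exp_bound[where K = 1 and c = 1]) auto
  have [simp]: "integrable (gaussian t) (\<lambda>z. (\<sigma> z)\<^sup>2)"
  proof (rule integrable_gaussian_of_exp_bound[where K = "c0\<^sup>2" and c = "2 * c1"])
    show "\<bar>(\<sigma> z)\<^sup>2\<bar> \<le> c0\<^sup>2 * exp (2 * c1 * \<bar>z\<bar>)" for z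
      using power_mono[OF bound[of z], of 2]
      by (simp add: power_mult_distrib mult.assoc exp_double)
  qed (use t in auto)
  have [simp]: "integrable (gaussian t) (\<lambda>z. z\<^sup>2)"
  proof (rule integrable_gaussian_of_exp_bound[where K = 1 and c = 2])
    show "\<bar>z\<^sup>2\<bar> \<le> 1 * exp (2 * \<bar>z\<bar>)" for z :: real
      using power_mono[OF id_le[of z], of 2] by (simp add: exp_double)
  qed (use t in auto)
  have [simp]: "integrable (gaussian t) (\<lambda>z. z * \<sigma> z)"
  proof (rule integrable_gaussian_of_exp_bound[where K = c0 and c = "1 + c1"])
    show "\<bar>z * \<sigma> z\<bar> \<le> c0 * exp ((1 + c1) * \<bar>z\<bar>)" for z
    proof -
      have "\<bar>z * \<sigma> z\<bar> \<le> exp \<bar>z\<bar> * (c0 * exp (c1 * \<bar>z\<bar>))"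
        unfolding abs_mult using id_le bound by (rule mult_mono) auto
      also have "\<dots> = c0 * exp (\<bar>z\<bar> + c1 * \<bar>z\<bar>)"
        unfolding exp_add by (simp only: mult_ac)
      finally show ?thesis
        by (simp add: distrib_right)
    qed
  qed (use t in auto)
  define m where "m = G.expectation \<sigma>"
  define e where "e = (LINT z|gaussian t. z * \<sigma> z)"
  define a where "a = e / t"
  have eta: "eta \<sigma> t = (LINT z|gaussian t. (\<sigma> z)\<^sup>2) - m\<^sup>2"
    unfolding eta_def m_def by (rule G.variance_eq) auto
  have "0 \<le> (LINT z|gaussian t. (\<sigma> z - m - a * z)\<^sup>2)"
    by simp
  also have "\<dots> = (LINT z|gaussian t. (\<sigma> z)\<^sup>2 + m\<^sup>2 + a\<^sup>2 * z\<^sup>2 - 2 * m * \<sigma> z - 2 * a * (z * \<sigma> z) + 2 * m * a * z)"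
    by (intro Bochner_Integration.integral_cong) (auto simp: power2_eq_square algebra_simps)
  also have "\<dots> = (LINT z|gaussian t. (\<sigma> z)\<^sup>2) + m\<^sup>2 + a\<^sup>2 * t - 2 * m * m - 2 * a * e"
    using t by (simp add: G.prob_space expectation_gaussian flip: m_def e_def)
  finally have "0 \<le> eta \<sigma> t + a\<^sup>2 * t - 2 * a * e"
    unfolding eta by (simp add: power2_eq_square)
  \<comment> \<open>\<open>zeta\<close> is the variance of the linear part \<open>a * z\<close>, so
    the residual variance just computed is \<open>eta - zeta\<close>.\<close>
  moreover have "zeta \<sigma> t = a\<^sup>2 * t" and "a * e = a\<^sup>2 * t"
    using t unfolding zeta_def rho_def a_def e_def by (simp_all add: power2_eq_square)
  ultimately show ?thesis
    by simp
qed

section \<open>Signs of the activation constants\<close>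

lemma rho_pos:
  assumes "Omega_well_defined \<sigma> t"
  shows "rho \<sigma> t > 0"
  using assms unfolding Omega_well_defined_def zeta_def rho_def by auto

lemma zeta_pos:
  assumes "Omega_well_defined \<sigma> t"
  shows "zeta \<sigma> t > 0"
  using assms rho_pos[OF assms] unfolding Omega_well_defined_def zeta_def by auto

lemma rho_omega:
  assumes "Omega_well_defined \<sigma> t"
  shows "rho \<sigma> t * omega \<sigma> t = eta \<sigma> t - zeta \<sigma> t"
  using assms rho_pos[OF assms] unfolding Omega_well_defined_def omega_def zeta_def
  by (simp add: field_simps)

lemma omega_nonneg:
  assumes "admissible_activation \<sigma>" and "Omega_well_defined \<sigma> t"
  shows "omega \<sigma> t \<ge> 0"
  using rho_omega[OF assms(2)] rho_pos[OF assms(2)] zeta_le_eta[OF assms(1), of t] assms(2)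
  unfolding Omega_well_defined_def by (metis diff_ge_0_iff_ge zero_le_mult_iff not_less)

section \<open>Comparison of overlap integrals\<close>

text \<open>Chebyshev's association inequality: integrate
  \<open>(g1 a * g2 b - g1 b * g2 a) * (h a - h b) \<le> 0\<close> over \<open>a\<close> and \<open>b\<close>.\<close>

lemma integral_mult_le_of_ratio_mono:
  fixes g1 g2 h :: "real \<Rightarrow> real"
  assumes [simp]: "integrable m g1" "integrable m g2"
    "integrable m (\<lambda>l. g1 l * h l)" "integrable m (\<lambda>l. g2 l * h l)"
    and S: "AE l in m. l \<in> S"
    and cross: "\<And>a b. a \<in> S \<Longrightarrow> b \<in> S \<Longrightarrow> a \<le> b \<Longrightarrow> g1 a * g2 b \<le> g1 b * g2 a"
    and h: "\<And>a b. a \<in> S \<Longrightarrow> b \<in> S \<Longrightarrow> a \<le> b \<Longrightarrow> h b \<le> h a"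
  shows "(LINT l|m. g1 l * h l) * (LINT l|m. g2 l) \<le> (LINT l|m. g1 l) * (LINT l|m. g2 l * h l)"
proof -
  define A where "A = (LINT l|m. g1 l * h l)"
  define B where "B = (LINT l|m. g1 l)"
  define C where "C = (LINT l|m. g2 l * h l)"
  define D where "D = (LINT l|m. g2 l)"
  have pair: "(g1 a * g2 b - g1 b * g2 a) * (h a - h b) \<le> 0" if "a \<in> S" "b \<in> S" for a b
    using cross[of a b] cross[of b a] h[of a b] h[of b a] that
    by (cases "a \<le> b") (auto simp: mult_le_0_iff)
  have "A * g2 b - B * (g2 b * h b) - C * g1 b + D * (g1 b * h b) \<le> 0" if b: "b \<in> S" for b
  proof -
    have "A * g2 b - B * (g2 b * h b) - C * g1 b + D * (g1 b * h b)
        = (LINT a|m. g2 b * (g1 a * h a) - g2 b * h b * g1 a - g1 b * (g2 a * h a) + g1 b * h b * g2 a)"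
      unfolding A_def B_def C_def D_def by simp
    also have "\<dots> = (LINT a|m. (g1 a * g2 b - g1 b * g2 a) * (h a - h b))"
      by (intro Bochner_Integration.integral_cong) (auto simp: algebra_simps)
    also have "\<dots> \<le> (LINT a|m. 0)"
    proof (rule integral_mono_AE)
      have "integrable m (\<lambda>a. g2 b * (g1 a * h a) - g2 b * h b * g1 a - g1 b * (g2 a * h a) + g1 b * h b * g2 a)"
        by simp
      then show "integrable m (\<lambda>a. (g1 a * g2 b - g1 b * g2 a) * (h a - h b))"
        by (rule Bochner_Integration.integrable_cong[THEN iffD1, rotated 2])
          (auto simp: algebra_simps)
      show "AE a in m. (g1 a * g2 b - g1 b * g2 a) * (h a - h b) \<le> 0"
        using S by eventually_elim (rule pair[OF _ b])
    qed simp
    finally show ?thesis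
      by simp
  qed
  then have "AE b in m. A * g2 b - B * (g2 b * h b) - C * g1 b + D * (g1 b * h b) \<le> 0"
    by - (rule AE_mp[OF S AE_I2], simp)
  then have "(LINT b|m. A * g2 b - B * (g2 b * h b) - C * g1 b + D * (g1 b * h b)) \<le> (LINT b|m. 0)"
    by (intro integral_mono_AE) simp_all
  then have "A * D - B * C - C * B + D * A \<le> 0"
    by (simp flip: A_def B_def C_def D_def)
  then show ?thesis
    unfolding A_def B_def C_def D_def by (simp add: mult.commute)
qed

text \<open>Every point outside the support lies in a null basis set, and there are only countably
  many basis sets.\<close>

lemma AE_topological_support:
  fixes M :: "'a::second_countable_topology measure"
  assumes "sets M = sets borel"
  shows "AE x in M. x \<in> topological_support M"
proof -
  obtain \<B> :: "'a set set" where \<B>: "countable \<B>" "topological_basis \<B>"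
    using ex_countable_basis by blast
  define I where "I = {B \<in> \<B>. emeasure M B = 0}"
  have "(\<Union>B\<in>I. B) \<in> null_sets M"
  proof (rule null_sets_UN')
    show "countable I"
      unfolding I_def using \<B>(1) by (rule countable_subset[rotated]) (rule Collect_restrict)
    show "B \<in> null_sets M" if "B \<in> I" for B
      using that topological_basis_open[OF \<B>(2), of B] assms unfolding I_def null_sets_def by simp
  qed
  moreover have "x \<in> (\<Union>B\<in>I. B)" if x: "x \<notin> topological_support M" for x
  proof -
    obtain U where U: "open U" "x \<in> U" "emeasure M U = 0"
      using x unfolding topological_support_def zero_less_iff_neq_zero by blast
    obtain B where B: "B \<in> \<B>" "x \<in> B" "B \<subseteq> U"
      by (rule topological_basisE[OF \<B>(2) U(1,2)])
    have "emeasure M B \<le> emeasure M U"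
      using B(3) U(1) assms by (intro emeasure_mono) simp_all
    then have "B \<in> I"
      using B(1) U(3) unfolding I_def by simp
    with B(2) show ?thesis
      by (rule UN_I[rotated])
  qed
  then have "{x \<in> space M. x \<notin> topological_support M} \<subseteq> (\<Union>B\<in>I. B)"
    by blast
  ultimately show ?thesis
    by (rule AE_I')
qed

section \<open>Integrability and conditional expectation of the overlap\<close>

lemma measurable_fst_snd_borel:
  fixes \<mu> :: "(real \<times> real) measure"
  assumes "sets \<mu> = sets borel"
  shows "fst \<in> borel_measurable \<mu>" and "snd \<in> borel_measurable \<mu>"
  using assms
  by (auto simp: measurable_cong_sets[OF assms refl] intro!: borel_measurable_continuous_onI continuous_intros)

lemma LJSD_prob_space: "LJSD \<mu> \<Longrightarrow> prob_space \<mu>"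
  and LJSD_sets: "LJSD \<mu> \<Longrightarrow> sets \<mu> = sets borel"
  and train_scale_pos: "LJSD \<mu> \<Longrightarrow> train_scale \<mu> > 0"
  and test_scale_pos: "LJSD \<mu> \<Longrightarrow> test_scale \<mu> > 0"
  unfolding LJSD_def train_scale_def test_scale_def by auto

lemma LJSD_AE_nonneg:
  assumes "LJSD \<mu>"
  shows "AE p in \<mu>. 0 \<le> fst p" and "AE p in \<mu>. 0 \<le> snd p"
proof -
  obtain C where C: "AE p in \<mu>. p \<in> {0..C} \<times> {0..C}"
    using assms unfolding LJSD_def by auto
  show "AE p in \<mu>. 0 \<le> fst p" and "AE p in \<mu>. 0 \<le> snd p"
    using C by (eventually_elim, auto)+
qed

lemma LJSD_integrable:
  fixes h :: "real \<Rightarrow> real"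
  assumes \<mu>: "LJSD \<mu>" and [measurable]: "h \<in> borel_measurable borel"
    and K: "\<forall>l\<ge>0. \<bar>h l\<bar> \<le> K"
  shows "integrable \<mu> (\<lambda>p. fst p * h (fst p))" and "integrable \<mu> (\<lambda>p. snd p * h (fst p))"
    and "integrable \<mu> (\<lambda>p. h (fst p))"
proof -
  note [measurable] = measurable_fst_snd_borel[OF LJSD_sets[OF \<mu>]]
  interpret prob_space \<mu>
    using \<mu> by (rule LJSD_prob_space)
  obtain C where C: "AE p in \<mu>. p \<in> {0..C} \<times> {0..C}"
    using \<mu> unfolding LJSD_def by auto
  have "K \<ge> 0"
    using K by force
  have "AE p in \<mu>. norm (h (fst p)) \<le> K"
    using C by eventually_elim (use K in auto)
  then show "integrable \<mu> (\<lambda>p. h (fst p))"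
    by (rule integrable_const_bound) measurable
  have "AE p in \<mu>. norm (fst p * h (fst p)) \<le> C * K"
    using C by eventually_elim (use K in \<open>auto simp: abs_mult intro!: mult_mono\<close>)
  then show "integrable \<mu> (\<lambda>p. fst p * h (fst p))"
    by (rule integrable_const_bound) measurable
  have "AE p in \<mu>. norm (snd p * h (fst p)) \<le> C * K"
    using C by eventually_elim (use K in \<open>auto simp: abs_mult intro!: mult_mono\<close>)
  then show "integrable \<mu> (\<lambda>p. snd p * h (fst p))"
    by (rule integrable_const_bound) measurable
qed

text \<open>A function of the eigenvalue is measurable for the \<sigma>-algebra generated by
  \<open>fst\<close> and can be pulled into the conditional expectation. This moves overlap
  integrals to the marginal, the common space on which two distributions can be compared.\<close>

lemma overlap_given_eigenvalue_integral:
  fixes h :: "real \<Rightarrow> real"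
  assumes \<mu>: "LJSD \<mu>" and g: "overlap_given_eigenvalue \<mu> g"
    and h[measurable]: "h \<in> borel_measurable borel"
    and K: "\<forall>l\<ge>0. \<bar>h l\<bar> \<le> K"
  shows "integrable (train_marginal \<mu>) (\<lambda>l. g l * h l)"
    and "(LINT l|train_marginal \<mu>. g l * h l) = (LINT p|\<mu>. snd p * h (fst p))"
    and "AE l in train_marginal \<mu>. g l \<ge> 0"
proof -
  note [measurable] = measurable_fst_snd_borel[OF LJSD_sets[OF \<mu>]]
  let ?F = "vimage_algebra UNIV fst (borel :: real measure) :: (real \<times> real) measure"
  let ?E = "real_cond_exp \<mu> ?F snd"
  have [measurable]: "g \<in> borel_measurable borel" and E: "AE p in \<mu>. ?E p = g (fst p)"
    using g unfolding overlap_given_eigenvalue_def by auto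
  interpret prob_space \<mu>
    using \<mu> by (rule LJSD_prob_space)
  have space: "space \<mu> = UNIV"
    using sets_eq_imp_space_eq[OF LJSD_sets[OF \<mu>]] by simp
  have "sets ?F \<subseteq> sets \<mu>"
    using measurable_sets[OF measurable_fst_snd_borel(1)[OF LJSD_sets[OF \<mu>]]]
    by (auto simp: sets_vimage_algebra2 space)
  then have "subalgebra \<mu> ?F"
    by (simp add: subalgebra_def space)
  then interpret F: finite_measure_subalgebra \<mu> ?F
    by unfold_locales
  have [measurable]: "(\<lambda>p. h (fst p)) \<in> borel_measurable ?F"
    by (rule measurable_compose[OF measurable_vimage_algebra1 h]) simp
  have [measurable]: "?E \<in> borel_measurable \<mu>"
    by (rule borel_measurable_cond_exp2)
  have int: "integrable \<mu> (\<lambda>p. h (fst p) * snd p)"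
    using LJSD_integrable(2)[OF \<mu> h K] by (simp add: mult.commute)
  have ae: "AE p in \<mu>. h (fst p) * ?E p = g (fst p) * h (fst p)"
    using E by (auto elim!: AE_mp)
  have "integrable \<mu> (\<lambda>p. g (fst p) * h (fst p))"
    using F.real_cond_exp_intg(1)[OF int] ae by (subst integrable_cong_AE[symmetric]) auto
  then show "integrable (train_marginal \<mu>) (\<lambda>l. g l * h l)"
    unfolding train_marginal_def by (subst integrable_distr_eq) auto
  have "(LINT l|train_marginal \<mu>. g l * h l) = (LINT p|\<mu>. g (fst p) * h (fst p))"
    unfolding train_marginal_def by (subst integral_distr) auto
  also have "\<dots> = (LINT p|\<mu>. h (fst p) * ?E p)"
    using ae by (intro integral_cong_AE) (auto elim!: AE_mp)
  also have "\<dots> = (LINT p|\<mu>. h (fst p) * snd p)"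
    using int by (rule F.real_cond_exp_intg(2)) auto
  finally show "(LINT l|train_marginal \<mu>. g l * h l) = (LINT p|\<mu>. snd p * h (fst p))"
    by (simp add: mult.commute)
  have "AE p in \<mu>. ?E p \<ge> 0"
    using LJSD_AE_nonneg(2)[OF \<mu>] by (rule F.real_cond_exp_pos) simp
  then have "AE p in \<mu>. g (fst p) \<ge> 0"
    using E by eventually_elim simp
  then show "AE l in train_marginal \<mu>. g l \<ge> 0"
    unfolding train_marginal_def by (subst AE_distr_iff) auto
qed

text \<open>If \<open>a\<close> or \<open>d\<close> vanishes, the left side is 0. Otherwise the
  right ratio is finite, hence so is the left one, which forces \<open>b > 0\<close> and permits
  ordinary cross multiplication.\<close>

lemma cross_le_of_ennreal_ratio_le:
  fixes a b c d :: real
  assumes "ennreal a / ennreal b \<le> ennreal c / ennreal d"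
    and "a \<ge> 0" "b \<ge> 0" "c \<ge> 0" "d \<ge> 0"
  shows "a * d \<le> c * b"
proof (cases "a = 0 \<or> d = 0")
  case False
  then have "a > 0" "d > 0"
    using assms by auto
  then have "ennreal c / ennreal d = ennreal (c / d)"
    using assms by (simp add: divide_ennreal)
  then have "ennreal a / ennreal b < \<infinity>"
    using assms(1) by (simp add: le_less_trans)
  then have "b > 0"
    using \<open>a > 0\<close> assms(3) by (cases "b = 0") (auto simp: ennreal_divide_zero)
  then have "a / b \<le> c / d"
    using assms \<open>d > 0\<close> by (simp add: divide_ennreal)
  then show ?thesis
    using \<open>b > 0\<close> \<open>d > 0\<close> by (simp add: field_simps)
qed (use assms in auto)

text \<open>Chebyshev's inequality compares the integrals normalised by the mean overlaps; the
  condition on \<open>c1\<close> and \<open>c2\<close> removes the normalisation. Weights 1 serve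
  the bias, weights \<open>rho\<close> at the test scales serve the variance.\<close>

lemma easier_integral_le:
  fixes h :: "real \<Rightarrow> real"
  assumes \<mu>1: "LJSD \<mu>1" and \<mu>2: "LJSD \<mu>2" and easier: "easier \<mu>1 \<mu>2"
    and h[measurable]: "h \<in> borel_measurable borel"
    and nonneg: "\<And>l. l \<ge> 0 \<Longrightarrow> 0 \<le> h l"
    and antimono: "\<And>a b. 0 \<le> a \<Longrightarrow> a \<le> b \<Longrightarrow> h b \<le> h a"
    and c: "0 \<le> c1" "c1 * test_scale \<mu>1 \<le> c2 * test_scale \<mu>2"
  shows "c1 * (LINT p|\<mu>1. snd p * h (fst p)) \<le> c2 * (LINT p|\<mu>2. snd p * h (fst p))"
proof -
  let ?L1 = "LINT p|\<mu>1. snd p * h (fst p)" and ?L2 = "LINT p|\<mu>2. snd p * h (fst p)"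
  let ?m = "train_marginal \<mu>1"
  obtain g1 g2 where g1: "overlap_given_eigenvalue \<mu>1 g1" and g2: "overlap_given_eigenvalue \<mu>2 g2"
    and ratio: "mono_on {l \<in> topological_support ?m. g1 l > 0 \<or> g2 l > 0}
        (\<lambda>l. ennreal (g1 l) / ennreal (g2 l))"
    and m: "train_marginal \<mu>1 = train_marginal \<mu>2"
    using easier unfolding easier_def by blast
  note [measurable] = measurable_fst_snd_borel[OF LJSD_sets[OF \<mu>1]]
  \<comment> \<open>The versions \<open>g1\<close> and \<open>g2\<close> may be negative on a null
    set; such points are excluded here, so that the ratios in [0, \<infinity>] reflect the real
    values.\<close>
  define S where "S = {l \<in> topological_support ?m. 0 \<le> l \<and> 0 \<le> g1 l \<and> 0 \<le> g2 l}"
  have bound: "\<forall>l\<ge>0. \<bar>h l\<bar> \<le> h 0"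
    using nonneg antimono[of 0] by simp
  note i1 = overlap_given_eigenvalue_integral[OF \<mu>1 g1 h bound]
  note i2 = overlap_given_eigenvalue_integral[OF \<mu>2 g2 h bound, folded m]
  note j1 = overlap_given_eigenvalue_integral[OF \<mu>1 g1, of "\<lambda>_. 1" 1, simplified]
  note j2 = overlap_given_eigenvalue_integral[OF \<mu>2 g2, of "\<lambda>_. 1" 1, folded m, simplified]
  have "AE l in ?m. 0 \<le> l"
    using LJSD_AE_nonneg(1)[OF \<mu>1] unfolding train_marginal_def by (subst AE_distr_iff) auto
  moreover have "AE l in ?m. l \<in> topological_support ?m"
    by (rule AE_topological_support) (simp add: train_marginal_def)
  ultimately have S: "AE l in ?m. l \<in> S"
    using i1(3) i2(3) unfolding S_def by eventually_elim auto
  have step: "?L1 * test_scale \<mu>2 \<le> test_scale \<mu>1 * ?L2"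
    unfolding test_scale_def i1(2)[symmetric] i2(2)[symmetric] j1(2)[symmetric] j2(2)[symmetric]
  proof (rule integral_mult_le_of_ratio_mono[OF j1(1) j2(1) i1(1) i2(1) S])
    fix a b
    assume ab: "a \<in> S" "b \<in> S" "a \<le> b"
    then show "h b \<le> h a"
      unfolding S_def by (auto intro: antimono)
    show "g1 a * g2 b \<le> g1 b * g2 a"
    \<comment> \<open>The monotonicity assumption says nothing about points of the form 0/0, but
      there both cross products are 0.\<close>
    proof (cases "g1 a = 0 \<and> g2 a = 0 \<or> g1 b = 0 \<and> g2 b = 0")
      case False
      then have "ennreal (g1 a) / ennreal (g2 a) \<le> ennreal (g1 b) / ennreal (g2 b)"
        using ab unfolding S_def by (intro mono_onD[OF ratio]) auto
      then show ?thesis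
        using ab unfolding S_def by (intro cross_le_of_ennreal_ratio_le) auto
    qed auto
  qed
  have "AE p in \<mu>2. 0 \<le> snd p * h (fst p)"
    using LJSD_AE_nonneg[OF \<mu>2] by eventually_elim (simp add: nonneg)
  then have L2: "?L2 \<ge> 0"
    by (rule integral_nonneg_AE)
  have "(c1 * ?L1) * test_scale \<mu>2 \<le> (c1 * test_scale \<mu>1) * ?L2"
    using mult_left_mono[OF step c(1)] by (simp only: mult.assoc)
  also have "\<dots> \<le> (c2 * test_scale \<mu>2) * ?L2"
    using c(2) L2 by (rule mult_right_mono)
  also have "\<dots> = (c2 * ?L2) * test_scale \<mu>2"
    by (simp only: mult_ac)
  finally show ?thesis
    by (rule mult_right_le_imp_le) (rule test_scale_pos[OF \<mu>2])
qed

section \<open>The fixed point equation\<close>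

text \<open>The square root dominates the absolute value of \<open>\<psi> - \<phi>\<close>. The
  second expression is the one in \<open>tau_bar\<close>; it equals the first with \<phi> and \<psi>
  exchanged.\<close>

lemma tau_at_nonneg:
  assumes "\<phi> > 0" "\<psi> > 0" "\<gamma> > 0" "\<rho> > 0" "x \<ge> 0"
  shows "tau_at \<phi> \<psi> \<gamma> \<rho> x \<ge> 0"
    and "(\<phi> - \<psi>) / \<phi> * (1 / \<gamma>) + \<psi> / \<phi> * tau_at \<phi> \<psi> \<gamma> \<rho> x \<ge> 0"
proof -
  define s where "s = sqrt ((\<psi> - \<phi>)\<^sup>2 + 4 * x * \<psi> * \<phi> * \<gamma> / \<rho>)"
  have "sqrt ((\<psi> - \<phi>)\<^sup>2) \<le> s"
    unfolding s_def using assms by (intro real_sqrt_le_mono) simp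
  then have s: "s + \<psi> - \<phi> \<ge> 0" "s + \<phi> - \<psi> \<ge> 0"
    by simp_all
  show "tau_at \<phi> \<psi> \<gamma> \<rho> x \<ge> 0"
    using s assms unfolding tau_at_def s_def[symmetric] by simp
  have "(\<phi> - \<psi>) / \<phi> * (1 / \<gamma>) + \<psi> / \<phi> * tau_at \<phi> \<psi> \<gamma> \<rho> x = (s + \<phi> - \<psi>) / (2 * \<phi> * \<gamma>)"
    using assms unfolding tau_at_def s_def[symmetric] by (simp add: field_simps)
  then show "(\<phi> - \<psi>) / \<phi> * (1 / \<gamma>) + \<psi> / \<phi> * tau_at \<phi> \<psi> \<gamma> \<rho> x \<ge> 0"
    using s assms by simp
qed

section \<open>Positivity of \<open>I_fun\<close> at (1,1) and growth of its multiple by x\<close>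

lemma I_fun_nonneg:
  assumes \<mu>: "LJSD \<mu>" and "\<phi> > 0" "x \<ge> 0"
  shows "I_fun \<phi> \<mu> a b x \<ge> 0"
proof -
  have "AE p in \<mu>. 0 \<le> fst p ^ a / (\<phi> + x * fst p) ^ b"
    using LJSD_AE_nonneg(1)[OF \<mu>] by eventually_elim (use assms in simp)
  then have "0 \<le> (LINT p|\<mu>. fst p ^ a / (\<phi> + x * fst p) ^ b)"
    by (rule integral_nonneg_AE)
  then show ?thesis
    using assms unfolding I_fun_def by simp
qed

lemma LJSD_integrable_I11:
  assumes \<mu>: "LJSD \<mu>" and "\<phi> > 0" "x \<ge> 0"
  shows "integrable \<mu> (\<lambda>p. fst p / (\<phi> + x * fst p))"
proof -
  have "\<forall>l\<ge>0. \<bar>1 / (\<phi> + x * l)\<bar> \<le> 1 / \<phi>"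
    using assms by (simp add: frac_le)
  then show ?thesis
    using LJSD_integrable(1)[OF \<mu>, of "\<lambda>l. 1 / (\<phi> + x * l)" "1 / \<phi>"] by simp
qed

text \<open>Otherwise the eigenvalue would vanish almost surely, against its positive mean. Strict
  positivity keeps the denominator of the fixed point equation positive even when \<omega> =
  0.\<close>

lemma I11_pos:
  assumes \<mu>: "LJSD \<mu>" and "\<phi> > 0" "x \<ge> 0"
  shows "I_fun \<phi> \<mu> 1 1 x > 0"
proof (rule ccontr)
  assume "\<not> ?thesis"
  then have "(LINT p|\<mu>. fst p / (\<phi> + x * fst p)) = 0"
    using I_fun_nonneg[OF \<mu> assms(2,3), of 1 1] \<open>\<phi> > 0\<close>
    unfolding I_fun_def by (simp add: zero_less_mult_iff zero_le_mult_iff)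
  moreover have "AE p in \<mu>. 0 \<le> fst p / (\<phi> + x * fst p)"
    using LJSD_AE_nonneg(1)[OF \<mu>] by eventually_elim (use assms in simp)
  ultimately have "AE p in \<mu>. fst p / (\<phi> + x * fst p) = 0"
    using integral_nonneg_eq_0_iff_AE[OF LJSD_integrable_I11[OF assms]] by simp
  then have "AE p in \<mu>. fst p = 0"
    using LJSD_AE_nonneg(1)[OF \<mu>]
  proof eventually_elim
    case (elim p)
    moreover have "\<phi> + x * fst p > 0"
      using elim(2) assms by (simp add: add_pos_nonneg)
    ultimately show ?case
      by simp
  qed
  then have "train_scale \<mu> = 0"
    unfolding train_scale_def by (rule integral_eq_zero_AE)
  then show False
    using train_scale_pos[OF \<mu>] by simp
qed

lemma mult_I11:
  "x * I_fun \<phi> \<mu> 1 1 x = (LINT p|\<mu>. \<phi> * (x * fst p / (\<phi> + x * fst p)))"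
  unfolding I_fun_def by (simp flip: integral_mult_right_zero add: mult_ac)

text \<open>The difference is exactly \<open>(y - x) * l\<close> times
  \<open>\<phi>\<^sup>2 / (X * Y)\<close>, a factor between 0 and 1. Integrated, the two bounds give
  monotonicity and a Lipschitz constant.\<close>

lemma saturation_diff:
  fixes \<phi> l x y :: real
  assumes "\<phi> > 0" "l \<ge> 0" "0 \<le> x" "x \<le> y"
  shows "\<phi> * (x * l / (\<phi> + x * l)) \<le> \<phi> * (y * l / (\<phi> + y * l))"
    and "\<phi> * (y * l / (\<phi> + y * l)) - \<phi> * (x * l / (\<phi> + x * l)) \<le> (y - x) * l"
proof -
  define X where "X = \<phi> + x * l"
  define Y where "Y = \<phi> + y * l"
  have XY: "X \<ge> \<phi>" "Y \<ge> \<phi>" "X > 0" "Y > 0"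
    using assms unfolding X_def Y_def by (auto simp: add_pos_nonneg)
  have eq: "\<phi> * (y * l / Y) - \<phi> * (x * l / X) = (y - x) * l * (\<phi>\<^sup>2 / (X * Y))"
    using XY unfolding X_def Y_def by (simp add: field_simps power2_eq_square)
  have "\<phi>\<^sup>2 \<le> X * Y"
    unfolding power2_eq_square using XY assms by (intro mult_mono) auto
  then have frac: "0 \<le> \<phi>\<^sup>2 / (X * Y)" "\<phi>\<^sup>2 / (X * Y) \<le> 1"
    using XY by (auto simp: divide_le_eq)
  have nonneg: "0 \<le> (y - x) * l"
    using assms by simp
  show "\<phi> * (x * l / (\<phi> + x * l)) \<le> \<phi> * (y * l / (\<phi> + y * l))"
    using eq mult_nonneg_nonneg[OF nonneg frac(1)] unfolding X_def Y_def by linarith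
  show "\<phi> * (y * l / (\<phi> + y * l)) - \<phi> * (x * l / (\<phi> + x * l)) \<le> (y - x) * l"
    using eq mult_left_mono[OF frac(2) nonneg] unfolding X_def Y_def by simp
qed

lemma mult_I11_diff:
  assumes \<mu>: "LJSD \<mu>" and \<phi>: "\<phi> > 0" and xy: "0 \<le> x" "x \<le> y"
  shows "x * I_fun \<phi> \<mu> 1 1 x \<le> y * I_fun \<phi> \<mu> 1 1 y"
    and "y * I_fun \<phi> \<mu> 1 1 y - x * I_fun \<phi> \<mu> 1 1 x \<le> (y - x) * train_scale \<mu>"
proof -
  have int: "integrable \<mu> (\<lambda>p. \<phi> * (z * fst p / (\<phi> + z * fst p)))" if "z \<ge> 0" for z
    using integrable_mult_right[OF LJSD_integrable_I11[OF \<mu> \<phi> that], of "\<phi> * z"]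
    by (simp add: mult.assoc)
  have int1: "integrable \<mu> (\<lambda>p. (y - x) * fst p)"
    using LJSD_integrable(1)[OF \<mu>, of "\<lambda>_. 1" 1] by simp
  have y: "y \<ge> 0"
    using xy by simp
  show "x * I_fun \<phi> \<mu> 1 1 x \<le> y * I_fun \<phi> \<mu> 1 1 y"
    unfolding mult_I11
  proof (rule integral_mono_AE[OF int int])
    show "AE p in \<mu>. \<phi> * (x * fst p / (\<phi> + x * fst p)) \<le> \<phi> * (y * fst p / (\<phi> + y * fst p))"
      using LJSD_AE_nonneg(1)[OF \<mu>] by eventually_elim (rule saturation_diff(1)[OF \<phi> _ xy])
  qed (use xy y in auto)
  have "y * I_fun \<phi> \<mu> 1 1 y - x * I_fun \<phi> \<mu> 1 1 x
      = (LINT p|\<mu>. \<phi> * (y * fst p / (\<phi> + y * fst p)) - \<phi> * (x * fst p / (\<phi> + x * fst p)))"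
    unfolding mult_I11
    by (rule Bochner_Integration.integral_diff[OF int int, symmetric]) (use xy y in auto)
  also have "\<dots> \<le> (LINT p|\<mu>. (y - x) * fst p)"
  proof (rule integral_mono_AE[OF Bochner_Integration.integrable_diff[OF int int] int1])
    show "AE p in \<mu>. \<phi> * (y * fst p / (\<phi> + y * fst p)) - \<phi> * (x * fst p / (\<phi> + x * fst p))
        \<le> (y - x) * fst p"
      using LJSD_AE_nonneg(1)[OF \<mu>] by eventually_elim (rule saturation_diff(2)[OF \<phi> _ xy])
  qed (use xy y in auto)
  finally show "y * I_fun \<phi> \<mu> 1 1 y - x * I_fun \<phi> \<mu> 1 1 x \<le> (y - x) * train_scale \<mu>"
    unfolding train_scale_def by simp
qed

text \<open>The description in \<open>x_root\<close> says something only if the root exists and is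
  unique. After clearing the denominator the equation reads \<open>F x = 1\<close> with
  \<open>F\<close> continuous and strictly increasing on the nonnegative reals, and \<open>F\<close>
  crosses 1 between 0 and \<open>\<rho> / \<gamma>\<close>.\<close>

lemma x_root_nonneg:
  assumes \<mu>: "LJSD \<mu>" and pos: "\<phi> > 0" "\<psi> > 0" "\<gamma> > 0"
    and \<rho>: "rho \<sigma> (train_scale \<mu>) > 0" and \<omega>: "omega \<sigma> (train_scale \<mu>) \<ge> 0"
  shows "x_root \<phi> \<psi> \<gamma> \<sigma> \<mu> \<ge> 0"
proof -
  define \<rho> where "\<rho> = rho \<sigma> (train_scale \<mu>)"
  define \<omega> where "\<omega> = omega \<sigma> (train_scale \<mu>)"
  note \<rho>\<omega> = \<rho>[folded \<rho>_def] \<omega>[folded \<omega>_def]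
  define T where "T = tau_at \<phi> \<psi> \<gamma> \<rho>"
  define K where "K x = I_fun \<phi> \<mu> 1 1 x" for x
  define F where "F x = x * \<omega> + x * K x + \<gamma> * T x" for x
  have eqn: "x = (1 - \<gamma> * T x) / (\<omega> + K x) \<longleftrightarrow> F x = 1" if "x \<ge> 0" for x
  proof -
    have "\<omega> + K x > 0"
      using I11_pos[OF \<mu> pos(1) that] \<rho>\<omega>(2) unfolding K_def by linarith
    then show ?thesis
      unfolding F_def by (auto simp: eq_divide_eq distrib_left)
  qed
  have T_less: "T x < T y" if "0 \<le> x" "x < y" for x y
  proof -
    have "x * (4 * \<psi> * \<phi> * \<gamma> / \<rho>) < y * (4 * \<psi> * \<phi> * \<gamma> / \<rho>)"
      using that(2) pos \<rho>\<omega> by (intro mult_strict_right_mono) auto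
    then have "sqrt ((\<psi> - \<phi>)\<^sup>2 + 4 * x * \<psi> * \<phi> * \<gamma> / \<rho>) < sqrt ((\<psi> - \<phi>)\<^sup>2 + 4 * y * \<psi> * \<phi> * \<gamma> / \<rho>)"
      by (intro real_sqrt_less_mono) (simp add: mult_ac)
    then show ?thesis
      unfolding T_def tau_at_def using pos by (intro divide_strict_right_mono) auto
  qed
  \<comment> \<open>Strictness comes from the square root in \<open>T\<close>; the other two
    summands are only shown to be nondecreasing.\<close>
  have F_less: "F x < F y" if "0 \<le> x" "x < y" for x y
  proof -
    have "x * K x \<le> y * K y"
      unfolding K_def using that by (intro mult_I11_diff(1)[OF \<mu> pos(1)]) auto
    moreover have "x * \<omega> \<le> y * \<omega>"
      using that \<rho>\<omega> by (intro mult_right_mono) auto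
    moreover have "\<gamma> * T x < \<gamma> * T y"
      using T_less[OF that] pos by simp
    ultimately show ?thesis
      unfolding F_def by linarith
  qed
  have "(train_scale \<mu>)-lipschitz_on {0..\<rho> / \<gamma>} (\<lambda>x. x * K x)"
  proof (rule lipschitz_on_leI)
    fix x y :: real
    assume "x \<in> {0..\<rho> / \<gamma>}" "y \<in> {0..\<rho> / \<gamma>}" "x \<le> y"
    then show "dist (x * K x) (y * K y) \<le> train_scale \<mu> * dist x y"
      using mult_I11_diff[OF \<mu> pos(1), of x y]
      unfolding K_def[symmetric] dist_real_def mult.commute[of "train_scale \<mu>"] by auto
  qed (use train_scale_pos[OF \<mu>] in simp)
  then have cont: "continuous_on {0..\<rho> / \<gamma>} (\<lambda>x. x * K x)"
    by (rule lipschitz_on_continuous_on)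
  have "continuous_on {0..\<rho> / \<gamma>} T"
    unfolding T_def tau_at_def using pos \<rho>\<omega>(1) by (intro continuous_intros) simp_all
  then have "continuous_on {0..\<rho> / \<gamma>} F"
    unfolding F_def
    by (intro continuous_on_add[OF continuous_on_add[OF _ cont]] continuous_on_mult
        continuous_on_id continuous_on_const)
  moreover have "F 0 \<le> 1"
  proof -
    have "\<gamma> * T 0 = (\<bar>\<psi> - \<phi>\<bar> + \<psi> - \<phi>) / (2 * \<psi>)"
      using pos unfolding T_def tau_at_def by simp
    also have "\<dots> \<le> 1"
      using pos by (subst divide_le_eq_1_pos) auto
    finally show ?thesis
      unfolding F_def by simp
  qed
  moreover have "1 \<le> F (\<rho> / \<gamma>)"
  proof -
    \<comment> \<open>The endpoint \<open>\<rho> / \<gamma>\<close> is chosen to make the radicand a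
      perfect square, whence \<open>\<gamma> * T\<close> is exactly 1 there.\<close>
    have "(\<psi> - \<phi>)\<^sup>2 + 4 * (\<rho> / \<gamma>) * \<psi> * \<phi> * \<gamma> / \<rho> = (\<psi> + \<phi>)\<^sup>2"
      using pos \<rho>\<omega> by (simp add: power2_eq_square algebra_simps)
    then have "\<gamma> * T (\<rho> / \<gamma>) = 1"
      using pos unfolding T_def tau_at_def by simp
    moreover have "K (\<rho> / \<gamma>) > 0"
      unfolding K_def using pos \<rho>\<omega> by (intro I11_pos[OF \<mu>]) auto
    ultimately show ?thesis
      using pos \<rho>\<omega> unfolding F_def by simp
  qed
  ultimately obtain x where x: "0 \<le> x" "F x = 1"
    using IVT'[of F 0 1 "\<rho> / \<gamma>"] divide_nonneg_pos[OF less_imp_le[OF \<rho>\<omega>(1)] pos(3)] by blast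
  have unique: "y = x" if "0 \<le> y" "F y = 1" for y
    using F_less[of x y] F_less[of y x] x that by linarith
  have "x_root \<phi> \<psi> \<gamma> \<sigma> \<mu> = x"
    unfolding x_root_def \<rho>_def[symmetric] \<omega>_def[symmetric] T_def[symmetric] K_def[symmetric]
    using x unique eqn by (intro the_equality) blast+
  then show ?thesis
    using x by simp
qed

section \<open>Monotonicity of bias and error\<close>

lemma train_marginal_cong:
  assumes \<mu>1: "LJSD \<mu>1" and \<mu>2: "LJSD \<mu>2" and eq: "train_marginal \<mu>1 = train_marginal \<mu>2"
  shows "train_scale \<mu>1 = train_scale \<mu>2" and "I_fun \<phi> \<mu>1 a b x = I_fun \<phi> \<mu>2 a b x"
proof -
  have marginal: "(LINT p|\<mu>. f (fst p)) = (LINT l|train_marginal \<mu>. f l)"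
    if "LJSD \<mu>" "f \<in> borel_measurable borel" for f :: "real \<Rightarrow> real" and \<mu>
    unfolding train_marginal_def
    by (rule integral_distr[symmetric, OF measurable_fst_snd_borel(1)[OF LJSD_sets[OF that(1)]] that(2)])
  show "train_scale \<mu>1 = train_scale \<mu>2"
    unfolding train_scale_def using marginal[of _ "\<lambda>l. l"] \<mu>1 \<mu>2 eq by simp
  have "(\<lambda>l. l ^ a / (\<phi> + x * l) ^ b) \<in> borel_measurable borel"
    by measurable
  then show "I_fun \<phi> \<mu>1 a b x = I_fun \<phi> \<mu>2 a b x"
    unfolding I_fun_def using marginal[of _ "\<lambda>l. l ^ a / (\<phi> + x * l) ^ b"] \<mu>1 \<mu>2 eq by simp
qed

lemma x_root_cong:
  assumes "LJSD \<mu>1" "LJSD \<mu>2" "train_marginal \<mu>1 = train_marginal \<mu>2"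
  shows "x_root \<phi> \<psi> \<gamma> \<sigma> \<mu>1 = x_root \<phi> \<psi> \<gamma> \<sigma> \<mu>2"
  unfolding x_root_def train_marginal_cong[OF assms] by (rule refl)

text \<open>This is the form E[r h(\<lambda>)] with nonincreasing h to which
  \<open>easier_integral_le\<close> applies.\<close>

lemma I_star_1: "I_star \<phi> \<mu> 1 b x = (LINT p|\<mu>. snd p * (\<phi> / (\<phi> + x * fst p) ^ b))"
  unfolding I_star_def by (simp flip: integral_mult_right_zero add: mult_ac)

lemma LJSD_integrable_I_star_1:
  assumes \<mu>: "LJSD \<mu>" and "\<phi> > 0" "x \<ge> 0"
  shows "integrable \<mu> (\<lambda>p. snd p * (\<phi> / (\<phi> + x * fst p) ^ b))"
proof (rule LJSD_integrable(2)[OF \<mu>])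
  have "\<phi> / (\<phi> + x * l) ^ b \<le> \<phi> / \<phi> ^ b" if "l \<ge> 0" for l
    using assms that by (intro divide_left_mono power_mono mult_pos_pos zero_less_power add_pos_nonneg) auto
  then show "\<forall>l\<ge>0. \<bar>\<phi> / (\<phi> + x * l) ^ b\<bar> \<le> \<phi> / \<phi> ^ b"
    using assms by simp
qed measurable

lemma easier_I_star_1_le:
  assumes "LJSD \<mu>1" "LJSD \<mu>2" "easier \<mu>1 \<mu>2" and pos: "\<phi> > 0" "x \<ge> 0"
    and "0 \<le> c1" "c1 * test_scale \<mu>1 \<le> c2 * test_scale \<mu>2"
  shows "c1 * I_star \<phi> \<mu>1 1 b x \<le> c2 * I_star \<phi> \<mu>2 1 b x"
  unfolding I_star_1
proof (rule easier_integral_le[OF assms(1-3)])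
  show "0 \<le> \<phi> / (\<phi> + x * l) ^ b" if "0 \<le> l" for l
    using pos that by simp
  show "\<phi> / (\<phi> + x * l') ^ b \<le> \<phi> / (\<phi> + x * l) ^ b" if "0 \<le> l" "l \<le> l'" for l l'
    using pos that
    by (intro divide_left_mono power_mono mult_pos_pos zero_less_power add_pos_nonneg
        add_left_mono mult_left_mono mult_nonneg_nonneg) auto
qed (use assms(6,7) in \<open>measurable\<close>)

text \<open>With u = \<phi> / (\<phi> + x \<lambda>), the quantities are E[r u], E[r u^2] and
  E[r u (1 - u)]. The identity is x \<lambda> = (\<phi> + x \<lambda>) - \<phi>, and the
  inequalities follow from 0 \<le> u \<le> 1.\<close>

lemma I_star_relations:
  assumes \<mu>: "LJSD \<mu>" and pos: "\<phi> > 0" "x \<ge> 0"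
  shows "x * I_star \<phi> \<mu> 2 2 x = I_star \<phi> \<mu> 1 1 x - \<phi> * I_star \<phi> \<mu> 1 2 x"
    and "0 \<le> I_star \<phi> \<mu> 1 2 x"
    and "\<phi> * I_star \<phi> \<mu> 1 2 x \<le> I_star \<phi> \<mu> 1 1 x"
    and "I_star \<phi> \<mu> 1 1 x \<le> test_scale \<mu>"
proof -
  note int = LJSD_integrable_I_star_1[OF \<mu> pos]
  note AE = LJSD_AE_nonneg[OF \<mu>]
  have diff: "I_star \<phi> \<mu> 1 1 x - \<phi> * I_star \<phi> \<mu> 1 2 x
      = (LINT p|\<mu>. snd p * (\<phi> / (\<phi> + x * fst p) ^ 1) - \<phi> * (snd p * (\<phi> / (\<phi> + x * fst p) ^ 2)))"
    unfolding I_star_1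
    by (simp only: Bochner_Integration.integral_diff[OF int integrable_mult_right[OF int]]
        integral_mult_right_zero)
  have eq: "snd p * (\<phi> / (\<phi> + x * fst p) ^ 1) - \<phi> * (snd p * (\<phi> / (\<phi> + x * fst p) ^ 2))
      = x * (\<phi> * (snd p * fst p ^ (2 - 1) / (\<phi> + x * fst p) ^ 2))" if "0 \<le> fst p" for p
  proof -
    define D where "D = \<phi> + x * fst p"
    have D: "D \<noteq> 0"
      using pos add_pos_nonneg[OF pos(1) mult_nonneg_nonneg[OF pos(2) that]] unfolding D_def by simp
    have "snd p * (\<phi> / D ^ 1) - \<phi> * (snd p * (\<phi> / D ^ 2)) = \<phi> * snd p * (D - \<phi>) / D ^ 2"
      using D by (simp add: field_simps power2_eq_square)
    also have "\<dots> = x * (\<phi> * (snd p * fst p ^ (2 - 1) / D ^ 2))"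
      by (simp add: D_def mult_ac)
    finally show ?thesis
      unfolding D_def .
  qed
  have [measurable]: "fst \<in> borel_measurable \<mu>" "snd \<in> borel_measurable \<mu>"
    using measurable_fst_snd_borel[OF LJSD_sets[OF \<mu>]] .
  have "I_star \<phi> \<mu> 1 1 x - \<phi> * I_star \<phi> \<mu> 1 2 x
      = (LINT p|\<mu>. x * (\<phi> * (snd p * fst p ^ (2 - 1) / (\<phi> + x * fst p) ^ 2)))"
    unfolding diff
  proof (rule integral_cong_AE)
    show "AE p in \<mu>. snd p * (\<phi> / (\<phi> + x * fst p) ^ 1) - \<phi> * (snd p * (\<phi> / (\<phi> + x * fst p) ^ 2))
      = x * (\<phi> * (snd p * fst p ^ (2 - 1) / (\<phi> + x * fst p) ^ 2))"
      using AE(1) by eventually_elim (rule eq)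
  qed measurable
  then show star22: "x * I_star \<phi> \<mu> 2 2 x = I_star \<phi> \<mu> 1 1 x - \<phi> * I_star \<phi> \<mu> 1 2 x"
    unfolding I_star_def integral_mult_right_zero by simp
  have "AE p in \<mu>. 0 \<le> snd p * fst p ^ (2 - 1) / (\<phi> + x * fst p) ^ 2"
    using AE by eventually_elim simp
  then have "0 \<le> x * I_star \<phi> \<mu> 2 2 x"
    unfolding I_star_def using pos by (intro mult_nonneg_nonneg integral_nonneg_AE) auto
  then show "\<phi> * I_star \<phi> \<mu> 1 2 x \<le> I_star \<phi> \<mu> 1 1 x"
    unfolding star22 by simp
  have "AE p in \<mu>. 0 \<le> snd p * (\<phi> / (\<phi> + x * fst p) ^ 2)"
    using AE by eventually_elim (use pos in simp)
  then show "0 \<le> I_star \<phi> \<mu> 1 2 x"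
    unfolding I_star_1 by (rule integral_nonneg_AE)
  show "I_star \<phi> \<mu> 1 1 x \<le> test_scale \<mu>"
    unfolding I_star_1 test_scale_def
  proof (rule integral_mono_AE[OF int])
    show "integrable \<mu> snd"
      using LJSD_integrable(2)[OF \<mu>, of "\<lambda>_. 1" 1] by simp
    show "AE p in \<mu>. snd p * (\<phi> / (\<phi> + x * fst p) ^ 1) \<le> snd p"
      using AE
    proof eventually_elim
      case (elim p)
      then have "\<phi> / (\<phi> + x * fst p) ^ 1 \<le> 1"
        using pos by (simp add: divide_le_eq_1 add_pos_nonneg)
      with elim(2) show ?case
        by (metis mult.right_neutral mult_left_mono)
    qed
  qed
qed

text \<open>Both sides are \<open>E[r ((1 - \<xi> + \<xi> u)\<^sup>2 + \<xi>\<^sup>2 \<kappa> u (1 - u))]\<close> with \<open>s\<close>, \<open>U\<close> and \<open>W\<close> the expectations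
  of \<open>r\<close>, \<open>r u\<close> and \<open>r u\<^sup>2\<close>.\<close>

lemma bias_form_le:
  fixes s1 s2 U1 U2 W1 W2 \<xi>1 \<xi>2 \<kappa> :: real
  assumes \<xi>: "0 \<le> \<xi>2" "\<xi>2 \<le> \<xi>1" "\<xi>1 \<le> 1" and \<kappa>: "0 \<le> \<kappa>" "\<kappa> \<le> 1"
    and "W1 \<le> U1" "U1 \<le> s1" and le: "s1 \<le> s2" "U1 \<le> U2" "W1 \<le> W2"
  shows "(1 - \<xi>1)\<^sup>2 * s1 + 2 * (1 - \<xi>1) * \<xi>1 * U1 + \<xi>1\<^sup>2 * W1 + \<xi>1\<^sup>2 * \<kappa> * (U1 - W1)
    \<le> (1 - \<xi>2)\<^sup>2 * s2 + 2 * (1 - \<xi>2) * \<xi>2 * U2 + \<xi>2\<^sup>2 * W2 + \<xi>2\<^sup>2 * \<kappa> * (U2 - W2)"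
proof -
  define G where "G \<xi> s U W
    = (1 - \<xi>)\<^sup>2 * s + (2 * (1 - \<xi>) * \<xi> + \<xi>\<^sup>2 * \<kappa>) * U + \<xi>\<^sup>2 * (1 - \<kappa>) * W" for \<xi> s U W
  \<comment> \<open>First only \<xi> is varied. The change of \<open>G\<close> has the factor
    \<open>\<xi>1 - \<xi>2\<close>; the cofactor is nonnegative because \<kappa> \<le> 1 bounds the
    inner bracket by \<open>s1 - U1\<close> and \<open>\<xi>1 + \<xi>2 \<le> 2\<close>.\<close>
  have "(\<xi>1 + \<xi>2) * ((s1 - 2 * U1 + W1) + \<kappa> * (U1 - W1)) \<le> (\<xi>1 + \<xi>2) * (s1 - U1)"
    using assms mult_right_mono[of \<kappa> 1 "U1 - W1"] by (intro mult_left_mono) auto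
  also have "\<dots> \<le> 2 * (s1 - U1)"
    using assms by (intro mult_right_mono) auto
  finally have "0 \<le> (\<xi>1 - \<xi>2) * (2 * (s1 - U1) - (\<xi>1 + \<xi>2) * ((s1 - 2 * U1 + W1) + \<kappa> * (U1 - W1)))"
    using \<xi> by (intro mult_nonneg_nonneg) auto
  also have "\<dots> = G \<xi>2 s1 U1 W1 - G \<xi>1 s1 U1 W1"
    unfolding G_def by (simp add: algebra_simps power2_eq_square)
  finally have "G \<xi>1 s1 U1 W1 \<le> G \<xi>2 s1 U1 W1"
    by simp
  \<comment> \<open>Now \<xi> is fixed in [0, 1], and the coefficients of \<open>s\<close>,
    \<open>U\<close> and \<open>W\<close> in \<open>G\<close> are all nonnegative.\<close>
  also have "\<dots> \<le> G \<xi>2 s2 U2 W2"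
    unfolding G_def using assms
    by (intro add_mono mult_left_mono le add_nonneg_nonneg mult_nonneg_nonneg) auto
  finally show ?thesis
    unfolding G_def by (simp add: algebra_simps)
qed

text \<open>\<open>J22\<close> is eliminated in favour of \<open>U - W\<close>, so that its term can be merged with the bias; \<open>d\<close> is the
  inverse of the denominator in \<^const>\<open>dx_dgamma\<close>.\<close>

lemma variance_decomposition:
  fixes \<phi> \<psi> :: real
  assumes "\<phi> \<noteq> 0" "\<psi> \<noteq> 0" and "x * J22 = U - W"
  shows "r * (\<psi> / \<phi>) * (x * d) * (I11 * P * (\<omega> + U) + \<phi>\<^sup>2 / \<psi> * \<gamma> * \<tau>b * I12 * J22
      + \<gamma> * \<tau> * I22 * (\<omega> + W) + v * (P * (\<omega> + U) + \<phi> / \<psi> * \<gamma> * \<tau>b * J22))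
    = r * (\<gamma> * \<tau>b * (\<phi> * I12 + v) * d) * (U - W)
      + (\<psi> / \<phi>) * (x * d) * ((I11 + v) * P * (r * \<omega> + r * U) + \<gamma> * \<tau> * I22 * (r * \<omega> + r * W))"
  unfolding assms(3)[symmetric] using assms(1,2) by (simp add: field_simps power2_eq_square)

text \<open>Both sides have the form \<eta> - \<zeta>. With q = \<zeta>2/\<zeta>1, the hypotheses
  give \<eta>2 - \<zeta>2 \<ge> q (\<eta>1 - \<zeta>1), and q \<ge> 1 finishes because \<zeta>1
  \<le> \<eta>1.\<close>

lemma omega_form_le:
  assumes \<sigma>: "admissible_activation \<sigma>"
    and wd: "Omega_well_defined \<sigma> t1" "Omega_well_defined \<sigma> t2"
    and ratios: "1 \<le> zeta \<sigma> t2 / zeta \<sigma> t1" "zeta \<sigma> t2 / zeta \<sigma> t1 \<le> eta \<sigma> t2 / eta \<sigma> t1"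
  shows "rho \<sigma> t1 * omega \<sigma> t1 \<le> rho \<sigma> t2 * omega \<sigma> t2"
proof -
  note z = zeta_pos[OF wd(1)]
  have ez: "zeta \<sigma> t1 \<le> eta \<sigma> t1"
    using wd(1) by (intro zeta_le_eta[OF \<sigma>]) (simp add: Omega_well_defined_def)
  define q where "q = zeta \<sigma> t2 / zeta \<sigma> t1"
  have "q * eta \<sigma> t1 \<le> eta \<sigma> t2"
    using ratios(2) z ez unfolding q_def[symmetric] by (simp add: pos_le_divide_eq)
  moreover have "zeta \<sigma> t2 = q * zeta \<sigma> t1"
    unfolding q_def using z by simp
  moreover have "1 * (eta \<sigma> t1 - zeta \<sigma> t1) \<le> q * (eta \<sigma> t1 - zeta \<sigma> t1)"
    using ratios(1) ez unfolding q_def[symmetric] by (intro mult_right_mono) auto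
  ultimately show ?thesis
    unfolding rho_omega[OF wd(1)] rho_omega[OF wd(2)] by (simp add: right_diff_distrib)
qed

theorem proposition5p1:
  fixes \<phi> \<psi> \<gamma> v :: real
    and \<sigma> :: "real \<Rightarrow> real"
    and \<mu>1 \<mu>2 :: "(real \<times> real) measure"
  assumes "\<phi> > 0" and "\<psi> > 0" and "\<gamma> > 0" and "v \<ge> 0"
    and "admissible_activation \<sigma>"
    and "LJSD \<mu>1" and "LJSD \<mu>2"
    and "easier \<mu>1 \<mu>2"
    and "Omega_well_defined \<sigma> (train_scale \<mu>1)"
    and "Omega_well_defined \<sigma> (test_scale \<mu>1)"
    and "Omega_well_defined \<sigma> (test_scale \<mu>2)"
  shows "(xi \<sigma> \<mu>2 \<le> xi \<sigma> \<mu>1 \<and> xi \<sigma> \<mu>1 \<le> 1 \<longrightarrow>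
            limiting_bias \<phi> \<psi> \<gamma> \<sigma> \<mu>1 \<le> limiting_bias \<phi> \<psi> \<gamma> \<sigma> \<mu>2)
       \<and> (xi \<sigma> \<mu>2 \<le> xi \<sigma> \<mu>1 \<and> xi \<sigma> \<mu>1 \<le> 1 \<and>
            1 \<le> zeta \<sigma> (test_scale \<mu>2) / zeta \<sigma> (test_scale \<mu>1) \<and>
            zeta \<sigma> (test_scale \<mu>2) / zeta \<sigma> (test_scale \<mu>1)
              \<le> eta \<sigma> (test_scale \<mu>2) / eta \<sigma> (test_scale \<mu>1) \<and>
            v \<le> omega \<sigma> (train_scale \<mu>1) \<longrightarrow>
            limiting_error \<phi> \<psi> \<gamma> v \<sigma> \<mu>1 \<le> limiting_error \<phi> \<psi> \<gamma> v \<sigma> \<mu>2)"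
proof -
  note \<phi>\<psi>\<gamma> = assms(1-3) and v = assms(4) and \<sigma> = assms(5) and \<mu>1 = assms(6) and \<mu>2 = assms(7)
    and easier = assms(8) and wd = assms(9) and wd1 = assms(10) and wd2 = assms(11)
  have marginal: "train_marginal \<mu>1 = train_marginal \<mu>2" and s_le: "test_scale \<mu>1 \<le> test_scale \<mu>2"
    using easier unfolding easier_def test_scale_def by blast+
  \<comment> \<open>The quantities from \<open>x\<close> to \<open>\<kappa>\<close> depend on the
    distribution through its marginal only, so these names serve \<open>\<mu>2\<close> as
    well.\<close>
  define x where "x = x_root \<phi> \<psi> \<gamma> \<sigma> \<mu>1"
  define \<rho> where "\<rho> = rho \<sigma> (train_scale \<mu>1)"
  define \<omega> where "\<omega> = omega \<sigma> (train_scale \<mu>1)"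
  define \<tau> where "\<tau> = tau_at \<phi> \<psi> \<gamma> \<rho> x"
  define \<tau>b where "\<tau>b = (\<phi> - \<psi>) / \<phi> * (1 / \<gamma>) + \<psi> / \<phi> * \<tau>"
  define I where "I a b = I_fun \<phi> \<mu>1 a b x" for a b
  define P where "P = \<omega> + \<phi> * I 1 2"
  define d where "d = 1 / (\<gamma> + \<rho> * \<gamma> * (\<tau> * \<psi> / \<phi> + \<tau>b) * P)"
  define \<kappa> where "\<kappa> = \<rho> * \<gamma> * \<tau>b * (\<phi> * I 1 2 + v) * d"
  define U where "U \<mu> = I_star \<phi> \<mu> 1 1 x" for \<mu>
  define W where "W \<mu> = \<phi> * I_star \<phi> \<mu> 1 2 x" for \<mu>
  define r where "r \<mu> = rho \<sigma> (test_scale \<mu>)" for \<mu>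
  define N where "N \<mu> = r \<mu> * omega \<sigma> (test_scale \<mu>)" for \<mu>

  have \<rho>: "\<rho> > 0"
    unfolding \<rho>_def by (rule rho_pos[OF wd])
  have \<omega>: "\<omega> \<ge> 0"
    unfolding \<omega>_def by (rule omega_nonneg[OF \<sigma> wd])
  have x: "x \<ge> 0"
    unfolding x_def using \<rho> \<omega> unfolding \<rho>_def \<omega>_def by (rule x_root_nonneg[OF \<mu>1 \<phi>\<psi>\<gamma>])
  have \<tau>: "\<tau> \<ge> 0" "\<tau>b \<ge> 0"
    unfolding \<tau>_def \<tau>b_def by (rule tau_at_nonneg[OF \<phi>\<psi>\<gamma> \<rho> x])+
  have I: "I a b \<ge> 0" for a b
    unfolding I_def by (rule I_fun_nonneg[OF \<mu>1 \<phi>\<psi>\<gamma>(1) x])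
  have P: "P \<ge> 0"
    unfolding P_def using \<omega> I \<phi>\<psi>\<gamma> by simp
  have den: "0 < \<gamma> + \<rho> * \<gamma> * (\<tau> * \<psi> / \<phi> + \<tau>b) * P"
    using \<phi>\<psi>\<gamma> \<rho> \<tau> P by (intro add_pos_nonneg mult_nonneg_nonneg add_nonneg_nonneg) auto
  then have d: "d \<ge> 0"
    unfolding d_def by simp

  \<comment> \<open>Both functionals are rewritten once for any distribution with this marginal. The
    first summand of the variance has the shape of the last one in
    \<open>bias_form_le\<close>.\<close>
  have bias: "limiting_bias \<phi> \<psi> \<gamma> \<sigma> \<mu>
      = (1 - xi \<sigma> \<mu>)\<^sup>2 * test_scale \<mu> + 2 * (1 - xi \<sigma> \<mu>) * xi \<sigma> \<mu> * U \<mu> + (xi \<sigma> \<mu>)\<^sup>2 * W \<mu>"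
    and variance: "limiting_variance \<phi> \<psi> \<gamma> v \<sigma> \<mu> = (xi \<sigma> \<mu>)\<^sup>2 * \<kappa> * (U \<mu> - W \<mu>)
      + (\<psi> / \<phi>) * (x * d) * ((I 1 1 + v) * P * (N \<mu> + r \<mu> * U \<mu>) + \<gamma> * \<tau> * I 2 2 * (N \<mu> + r \<mu> * W \<mu>))"
    if \<mu>: "LJSD \<mu>" and m: "train_marginal \<mu> = train_marginal \<mu>1" for \<mu>
  proof -
    note cong = train_marginal_cong[OF \<mu> \<mu>1 m] x_root_cong[OF \<mu> \<mu>1 m]
    \<comment> \<open>The prefactor of the variance is thus \<open>rho\<close> at the test scale,
      which turns its terms into \<open>N\<close>, \<open>r * U\<close> and
      \<open>r * W\<close>.\<close>
    have r: "\<rho> * (xi \<sigma> \<mu>)\<^sup>2 = r \<mu>"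
      using \<rho> unfolding xi_def r_def \<rho>_def cong by (simp add: rho_def)
    have taus: "tau \<phi> \<psi> \<gamma> \<sigma> \<mu> = \<tau>" "tau_bar \<phi> \<psi> \<gamma> \<sigma> \<mu> = \<tau>b"
      unfolding tau_bar_def tau_def \<tau>b_def \<tau>_def x_def \<rho>_def cong by (rule refl)+
    have dx: "dx_dgamma \<phi> \<psi> \<gamma> \<sigma> \<mu> = - (x * d)"
      unfolding dx_dgamma_def Let_def taus cong d_def P_def I_def x_def \<rho>_def \<omega>_def by simp
    show "limiting_bias \<phi> \<psi> \<gamma> \<sigma> \<mu>
        = (1 - xi \<sigma> \<mu>)\<^sup>2 * test_scale \<mu> + 2 * (1 - xi \<sigma> \<mu>) * xi \<sigma> \<mu> * U \<mu> + (xi \<sigma> \<mu>)\<^sup>2 * W \<mu>"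
      unfolding limiting_bias_def Let_def cong U_def W_def x_def by simp
    have "limiting_variance \<phi> \<psi> \<gamma> v \<sigma> \<mu>
        = r \<mu> * (\<psi> / \<phi>) * (x * d) * (I 1 1 * P * (omega \<sigma> (test_scale \<mu>) + U \<mu>)
          + \<phi>\<^sup>2 / \<psi> * \<gamma> * \<tau>b * I 1 2 * I_star \<phi> \<mu> 2 2 x + \<gamma> * \<tau> * I 2 2 * (omega \<sigma> (test_scale \<mu>) + W \<mu>)
          + v * (P * (omega \<sigma> (test_scale \<mu>) + U \<mu>) + \<phi> / \<psi> * \<gamma> * \<tau>b * I_star \<phi> \<mu> 2 2 x))"
      unfolding limiting_variance_def Let_def taus dx cong r[symmetric] P_def I_def U_def W_def
        x_def[symmetric] \<rho>_def[symmetric] \<omega>_def[symmetric] by simp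
    also have "\<dots> = r \<mu> * (\<gamma> * \<tau>b * (\<phi> * I 1 2 + v) * d) * (U \<mu> - W \<mu>)
        + (\<psi> / \<phi>) * (x * d) * ((I 1 1 + v) * P * (N \<mu> + r \<mu> * U \<mu>) + \<gamma> * \<tau> * I 2 2 * (N \<mu> + r \<mu> * W \<mu>))"
      unfolding N_def using \<phi>\<psi>\<gamma> I_star_relations(1)[OF \<mu> \<phi>\<psi>\<gamma>(1) x]
      by (intro variance_decomposition) (auto simp: U_def W_def)
    also have "r \<mu> * (\<gamma> * \<tau>b * (\<phi> * I 1 2 + v) * d) = (xi \<sigma> \<mu>)\<^sup>2 * \<kappa>"
      unfolding r[symmetric] \<kappa>_def by (simp only: mult_ac)
    finally show "limiting_variance \<phi> \<psi> \<gamma> v \<sigma> \<mu> = (xi \<sigma> \<mu>)\<^sup>2 * \<kappa> * (U \<mu> - W \<mu>)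
      + (\<psi> / \<phi>) * (x * d) * ((I 1 1 + v) * P * (N \<mu> + r \<mu> * U \<mu>) + \<gamma> * \<tau> * I 2 2 * (N \<mu> + r \<mu> * W \<mu>))" .
  qed
  note eqs1 = bias[OF \<mu>1 refl] variance[OF \<mu>1 refl]
  note eqs2 = bias[OF \<mu>2 marginal[symmetric]] variance[OF \<mu>2 marginal[symmetric]]

  have star_le: "c1 * U \<mu>1 \<le> c2 * U \<mu>2" "c1 * W \<mu>1 \<le> c2 * W \<mu>2"
    if "0 \<le> c1" "c1 * test_scale \<mu>1 \<le> c2 * test_scale \<mu>2" for c1 c2
    using easier_I_star_1_le[OF \<mu>1 \<mu>2 easier \<phi>\<psi>\<gamma>(1) x that] \<phi>\<psi>\<gamma>(1)
    unfolding U_def W_def by (auto simp: mult.left_commute[of _ \<phi>])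
  have UW: "U \<mu>1 \<le> U \<mu>2" "W \<mu>1 \<le> W \<mu>2"
    using star_le[of 1 1] s_le by simp_all
  have bounds: "W \<mu>1 \<le> U \<mu>1" "U \<mu>1 \<le> test_scale \<mu>1"
    unfolding U_def W_def by (rule I_star_relations[OF \<mu>1 \<phi>\<psi>\<gamma>(1) x])+
  have xi2: "0 \<le> xi \<sigma> \<mu>2"
    unfolding xi_def rho_def by simp

  show ?thesis
  proof (intro conjI impI; elim conjE)
    assume "xi \<sigma> \<mu>2 \<le> xi \<sigma> \<mu>1" "xi \<sigma> \<mu>1 \<le> 1"
    \<comment> \<open>The bias alone is the case \<kappa> = 0 of
      \<open>bias_form_le\<close>.\<close>
    then show "limiting_bias \<phi> \<psi> \<gamma> \<sigma> \<mu>1 \<le> limiting_bias \<phi> \<psi> \<gamma> \<sigma> \<mu>2"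
      unfolding eqs1 eqs2
      using bias_form_le[OF xi2 _ _ order_refl zero_le_one bounds s_le UW] by simp
  next
    assume xi: "xi \<sigma> \<mu>2 \<le> xi \<sigma> \<mu>1" "xi \<sigma> \<mu>1 \<le> 1"
      and ratios: "1 \<le> zeta \<sigma> (test_scale \<mu>2) / zeta \<sigma> (test_scale \<mu>1)"
        "zeta \<sigma> (test_scale \<mu>2) / zeta \<sigma> (test_scale \<mu>1)
          \<le> eta \<sigma> (test_scale \<mu>2) / eta \<sigma> (test_scale \<mu>1)"
      and v_le: "v \<le> omega \<sigma> (train_scale \<mu>1)"
    have \<kappa>0: "\<kappa> \<ge> 0"
      unfolding \<kappa>_def using \<phi>\<psi>\<gamma> \<rho> \<tau> I v d by (intro mult_nonneg_nonneg add_nonneg_nonneg) auto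
    \<comment> \<open>The noise bound enters here: \<open>v \<le> \<omega>\<close> gives
      \<open>\<phi> * I 1 2 + v \<le> P\<close>, so the numerator of \<kappa> is at most a summand
      of its denominator.\<close>
    have "\<rho> * \<gamma> * \<tau>b * (\<phi> * I 1 2 + v) \<le> \<rho> * \<gamma> * (\<tau> * \<psi> / \<phi> + \<tau>b) * P"
      unfolding P_def using \<phi>\<psi>\<gamma> \<rho> \<tau> I v v_le[folded \<omega>_def] \<omega>
      by (intro mult_mono) (auto intro!: mult_nonneg_nonneg add_nonneg_nonneg)
    then have \<kappa>1: "\<kappa> \<le> 1"
      unfolding \<kappa>_def d_def using den \<phi>\<psi>\<gamma> by (simp add: pos_divide_le_eq)
    have r1: "0 \<le> r \<mu>1"
      unfolding r_def rho_def by simp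
    \<comment> \<open>These products are the values of \<open>zeta\<close>, so the first ratio
      hypothesis is the weight condition of \<open>star_le\<close>.\<close>
    have "r \<mu>1 * test_scale \<mu>1 \<le> r \<mu>2 * test_scale \<mu>2"
      using ratios(1) zeta_pos[OF wd1] unfolding r_def zeta_def by (simp add: mult.commute)
    note rUW = star_le[OF r1 this]
    have N: "N \<mu>1 \<le> N \<mu>2"
      unfolding N_def r_def by (rule omega_form_le[OF \<sigma> wd1 wd2 ratios])
    have "(\<psi> / \<phi>) * (x * d) * ((I 1 1 + v) * P * (N \<mu>1 + r \<mu>1 * U \<mu>1) + \<gamma> * \<tau> * I 2 2 * (N \<mu>1 + r \<mu>1 * W \<mu>1))
      \<le> (\<psi> / \<phi>) * (x * d) * ((I 1 1 + v) * P * (N \<mu>2 + r \<mu>2 * U \<mu>2) + \<gamma> * \<tau> * I 2 2 * (N \<mu>2 + r \<mu>2 * W \<mu>2))"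
      by (intro mult_left_mono add_mono N rUW mult_nonneg_nonneg add_nonneg_nonneg divide_nonneg_nonneg
          I v P x d \<tau> less_imp_le[OF \<phi>\<psi>\<gamma>(1)] less_imp_le[OF \<phi>\<psi>\<gamma>(2)] less_imp_le[OF \<phi>\<psi>\<gamma>(3)])
    \<comment> \<open>The \<kappa> term joins the bias and is compared by
      \<open>bias_form_le\<close>; the rest of the variance is the inequality just shown.\<close>
    then show "limiting_error \<phi> \<psi> \<gamma> v \<sigma> \<mu>1 \<le> limiting_error \<phi> \<psi> \<gamma> v \<sigma> \<mu>2"
      unfolding limiting_error_def eqs1 eqs2
      using bias_form_le[OF xi2 xi \<kappa>0 \<kappa>1 bounds s_le UW] by linarith
  qed
qed

end
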